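(* Let $A\in\mathbb{R}^{m\times n}$, $L\in\mathbb{R}^{p\times n}$ with $\mathrm{rank}((A^{\top},L^{\top})^{\top})=r$, let $M=A^{\top}A+L^{\top}L$, and let $A=P_AC_AX^{-1}$, $L=P_LS_LX^{-1}$ be a GSVD of $\{A,L\}$ (in the form given in the context) whose first $r$ right vectors satisfy $x_i\in\mathcal{R}(M)$, $1\le i\le r$. Define the linear operator $$\mathcal{A}:(\mathcal{R}(M),\langle\cdot,\cdot\rangle_M)\to(\mathbb{R}^m,\langle\cdot,\cdot\rangle_2),\quad v\mapsto Av .$$ Partition by columns $P_A=(P_{A1}\ P_{A2}\ P_{A3})$ with $q_1,\ q_2,\ m-q_1-q_2$ columns and $X=(X_1\ X_2\ X_3\ X_4)$ with $q_1,\ q_2,\ q_3,\ n-r$ columns, and let $\widetilde X_1=(X_1\ X_2\ X_3)\in\mathbb{R}^{n\times r}$. Then the SVE of $\mathcal{A}$ has the form $$\mathcal{A}\sim P_A\Sigma_A\widetilde X_1^{\top},$$ and $$\ker(\mathcal{A})=\mathcal{R}(X_3),\quad \mathrm{im}(\mathcal{A})=\mathcal{R}((P_{A1}\ P_{A2})),\quad \ker(\mathcal{A}^* )=\mathcal{R}(P_{A3}),\quad \mathrm{im}(\mathcal{A}^* )=\mathcal{R}((X_1\ X_2)).$$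
   Context: $\mathcal{R}(\cdot)$ is the range (column space) of a matrix. For symmetric positive semidefinite $M$, $\langle v,v'\rangle_M=v^{\top}Mv'$ is an inner product on $\mathcal{R}(M)$; $\langle\cdot,\cdot\rangle_2$ is the Euclidean inner product. $\mathcal{A}^*:\mathbb{R}^m\to\mathcal{R}(M)$ is the adjoint with respect to these inner products: $\langle\mathcal{A}v,u\rangle_2=\langle v,\mathcal{A}^*u\rangle_M$ for all $v\in\mathcal{R}(M)$, $u\in\mathbb{R}^m$. SVE notation: with $r=\mathrm{rank}(M)$, $\mathcal{A}\sim H\Sigma F^{\top}$ (singular value expansion of $\mathcal{A}$) means that $F\in\mathbb{R}^{n\times r}$ has columns in $\mathcal{R}(M)$ and is $M$-orthonormal ($F^{\top}MF=I_r$), $H\in\mathbb{R}^{m\times m}$ is orthogonal, $\Sigma\in\mathbb{R}^{m\times r}$ is (rectangular) diagonal with nonnegative entries, and $\mathcal{A}v=H\Sigma F^{\top}Mv$ for all $v\in\mathcal{R}(M)$ and $\mathcal{A}^*u=F\Sigma^{\top}H^{\top}u$ for all $u\in\mathbb{R}^m$. GSVD: for $A\in\mathbb{R}^{m\times n}$, $L\in\mathbb{R}^{p\times n}$ with $\mathrm{rank}((A^{\top},L^{\top})^{\top})=r$, a GSVD of $\{A,L\}$ is a pair of factorizations $A=P_AC_AX^{-1}$, $L=P_LS_LX^{-1}$ with $P_A\in\mathbb{R}^{m\times m}$, $P_L\in\mathbb{R}^{p\times p}$ orthogonal, $X=(x_1,\dots,x_n)\in\mathbb{R}^{n\times n}$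 invertible, $C_A=(\Sigma_A\ \ \mathbf{0})\in\mathbb{R}^{m\times n}$, $S_L=(\Sigma_L\ \ \mathbf{0})\in\mathbb{R}^{p\times n}$ (the zero blocks having $n-r$ columns), where $\Sigma_A\in\mathbb{R}^{m\times r}$ and $\Sigma_L\in\mathbb{R}^{p\times r}$ are block diagonal with (possibly rectangular or empty) diagonal blocks $$\Sigma_A:\ I_{q_1},\ C_{q_2},\ \mathbf{0}_{(m-q_1-q_2)\times q_3};\qquad \Sigma_L:\ \mathbf{0}_{(p-r+q_1)\times q_1},\ S_{q_2},\ I_{q_3},$$ with $q_1+q_2+q_3=r$, $C_{q_2}=\mathrm{diag}(c_{q_1+1},\dots,c_{q_1+q_2})$, $1>c_{q_1+1}\ge\cdots\ge c_{q_1+q_2}>0$, $S_{q_2}=\mathrm{diag}(s_{q_1+1},\dots,s_{q_1+q_2})$, $0<s_{q_1+1}\le\cdots\le s_{q_1+q_2}<1$, and $\Sigma_A^{\top}\Sigma_A+\Sigma_L^{\top}\Sigma_L=I_r$. *)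

theory Defs
  imports
    "HOL-Library.FuncSet"
    "Jordan_Normal_Form.DL_Rank"
    "Jordan_Normal_Form.Gauss_Jordan_Elimination"
begin

abbreviation mat_range :: "real mat \<Rightarrow> real vec set" where
  "mat_range B \<equiv> vec_space.col_space (dim_row B) B"

abbreviation mat_rank :: "real mat \<Rightarrow> nat" where
  "mat_rank B \<equiv> vec_space.rank (dim_row B) B"

abbreviation mat_inv :: "real mat \<Rightarrow> real mat" where
  "mat_inv X \<equiv> the (mat_inverse X)"

definition append_cols :: "real mat \<Rightarrow> real mat \<Rightarrow> real mat" (infixr \<open>@\<^sub>c\<close> 65) where
  "A @\<^sub>c B = four_block_mat A B (0\<^sub>m 0 (dim_col A)) (0\<^sub>m 0 (dim_col B))"

(* The library's orthogonal_mat only asks for pairwise orthogonal nonzero columns,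
   not for orthonormal ones. *)
definition orthonormal_mat :: "nat \<Rightarrow> real mat \<Rightarrow> bool" where
  "orthonormal_mat k Q \<longleftrightarrow> Q \<in> carrier_mat k k \<and> Q\<^sup>T * Q = 1\<^sub>m k \<and> Q * Q\<^sup>T = 1\<^sub>m k"

definition M_inner :: "real mat \<Rightarrow> real vec \<Rightarrow> real vec \<Rightarrow> real" where
  "M_inner M v w = v \<bullet> (M *\<^sub>v w)"

(* For symmetric positive semidefinite M, M_inner M is positive definite on mat_range M, so
   this w exists and is unique whenever T is linear from mat_range M to R^m and u is in R^m. *)
definition M_adjoint :: "real mat \<Rightarrow> (real vec \<Rightarrow> real vec) \<Rightarrow> real vec \<Rightarrow> real vec" where
  "M_adjoint M T u =
     (THE w. w \<in> mat_range M \<and> (\<forall>v\<in>mat_range M. T v \<bullet> u = M_inner M v w))"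

(* is_sve M m T H S F: the operator T from (mat_range M, M_inner M) to R^m has the
   singular value expansion H S F^T. *)
definition is_sve ::
  "real mat \<Rightarrow> nat \<Rightarrow> (real vec \<Rightarrow> real vec) \<Rightarrow> real mat \<Rightarrow> real mat \<Rightarrow> real mat \<Rightarrow> bool" where
  "is_sve M m T H S F \<longleftrightarrow>
     F \<in> carrier_mat (dim_row M) (mat_rank M) \<and>
     set (cols F) \<subseteq> mat_range M \<and>
     F\<^sup>T * M * F = 1\<^sub>m (mat_rank M) \<and>
     orthonormal_mat m H \<and>
     S \<in> carrier_mat m (mat_rank M) \<and>
     diagonal_mat S \<and>
     (\<forall>i<m. \<forall>j<mat_rank M. 0 \<le> S $$ (i, j)) \<and>
     (\<forall>v\<in>mat_range M. T v = (H * S * F\<^sup>T * M) *\<^sub>v v) \<and>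
     (\<forall>u\<in>carrier_vec m. M_adjoint M T u = (F * S\<^sup>T * H\<^sup>T) *\<^sub>v u)"

(* The values c and s are indexed from 1, so only those at q1 + 1, ..., q1 + q2 matter;
   the entries of mat_diag are indexed from 0. *)
definition gsvd_Sigma_A :: "nat \<Rightarrow> nat \<Rightarrow> nat \<Rightarrow> nat \<Rightarrow> (nat \<Rightarrow> real) \<Rightarrow> real mat" where
  "gsvd_Sigma_A m q1 q2 q3 c =
     diag_block_mat [1\<^sub>m q1, mat_diag q2 (\<lambda>i. c (q1 + 1 + i)), 0\<^sub>m (m - q1 - q2) q3]"

(* With r = q1 + q2 + q3, the zero block has p - r + q1 = p - q2 - q3 rows. *)
definition gsvd_Sigma_L :: "nat \<Rightarrow> nat \<Rightarrow> nat \<Rightarrow> nat \<Rightarrow> (nat \<Rightarrow> real) \<Rightarrow> real mat" where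
  "gsvd_Sigma_L p q1 q2 q3 s =
     diag_block_mat [0\<^sub>m (p - q2 - q3) q1, mat_diag q2 (\<lambda>i. s (q1 + 1 + i)), 1\<^sub>m q3]"

(* The inequalities q1 + q2 <= m and q2 + q3 <= p say that the block sizes m - q1 - q2 and
   p - q2 - q3 are genuine, i.e. that the subtractions above do not truncate. *)
definition is_gsvd ::
  "real mat \<Rightarrow> real mat \<Rightarrow> nat \<Rightarrow> nat \<Rightarrow> nat \<Rightarrow> (nat \<Rightarrow> real) \<Rightarrow> (nat \<Rightarrow> real) \<Rightarrow>
   real mat \<Rightarrow> real mat \<Rightarrow> real mat \<Rightarrow> bool" where
  "is_gsvd A L q1 q2 q3 c s P\<^sub>A P\<^sub>L X \<longleftrightarrow>
     (let m = dim_row A; p = dim_row L; n = dim_col A; r = mat_rank (A @\<^sub>r L);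
          \<Sigma>\<^sub>A = gsvd_Sigma_A m q1 q2 q3 c; \<Sigma>\<^sub>L = gsvd_Sigma_L p q1 q2 q3 s
      in dim_col L = n \<and>
         q1 + q2 + q3 = r \<and> q1 + q2 \<le> m \<and> q2 + q3 \<le> p \<and>
         (\<forall>i\<in>{q1+1..q1+q2}. 0 < c i \<and> c i < 1 \<and> 0 < s i \<and> s i < 1) \<and>
         (\<forall>i\<in>{q1+1..q1+q2}. \<forall>j\<in>{q1+1..q1+q2}. i \<le> j \<longrightarrow> c j \<le> c i \<and> s i \<le> s j) \<and>
         \<Sigma>\<^sub>A\<^sup>T * \<Sigma>\<^sub>A + \<Sigma>\<^sub>L\<^sup>T * \<Sigma>\<^sub>L = 1\<^sub>m r \<and>
         orthonormal_mat m P\<^sub>A \<and> orthonormal_mat p P\<^sub>L \<and>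
         X \<in> carrier_mat n n \<and> invertible_mat X \<and>
         A = P\<^sub>A * (\<Sigma>\<^sub>A @\<^sub>c 0\<^sub>m m (n - r)) * mat_inv X \<and>
         L = P\<^sub>L * (\<Sigma>\<^sub>L @\<^sub>c 0\<^sub>m p (n - r)) * mat_inv X)"

end

theory Submission
  imports Defs
begin

text \<open>
  Write \<open>X = (Y Z)\<close>, where \<open>Y\<close> consists of the first \<open>r\<close> columns. The factorizations give
  \<open>A Y = P\<^sub>A \<Sigma>\<^sub>A\<close>, \<open>L Y = P\<^sub>L \<Sigma>\<^sub>L\<close> and \<open>A Z = 0\<close>, \<open>L Z = 0\<close>, hence
  \<open>Y\<^sup>T M Y = \<Sigma>\<^sub>A\<^sup>T \<Sigma>\<^sub>A + \<Sigma>\<^sub>L\<^sup>T \<Sigma>\<^sub>L = I\<close> and \<open>M Z = 0\<close>. Range and kernel of the symmetric matrix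
  \<open>M\<close> are orthogonal, so the columns of \<open>Y\<close>, which lie in the range, span all of it. They are thus
  an \<open>M\<close>-orthonormal basis of the range, in which the operator has the matrix \<open>P\<^sub>A \<Sigma>\<^sub>A\<close> and its
  adjoint the matrix \<open>\<Sigma>\<^sub>A\<^sup>T P\<^sub>A\<^sup>T\<close>. Since \<open>\<Sigma>\<^sub>A\<close> is an invertible diagonal matrix of size
  \<open>q\<^sub>1 + q\<^sub>2\<close> bordered by zeros, the four subspaces can be read off.
\<close>

section \<open>Ranges and matrices assembled from column blocks\<close>

lemma mat_range_eq_image:
  fixes B :: "real mat"
  assumes "B \<in> carrier_mat m k"
  shows "vec_space.col_space m B = (*\<^sub>v) B ` carrier_vec k"
  using assms by (auto simp: vec_space.col_space_eq[OF assms])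

lemma mult_mat_zero_vec:
  fixes B :: "real mat"
  assumes "B \<in> carrier_mat m k"
  shows "B *\<^sub>v 0\<^sub>v k = 0\<^sub>v m"
  using assms by (intro eq_vecI) auto

lemma zero_mat_mult_vec:
  fixes x :: "real vec"
  assumes "x \<in> carrier_vec k"
  shows "0\<^sub>m m k *\<^sub>v x = 0\<^sub>v m"
  using assms by (intro eq_vecI) auto

lemma append_cols_carrier [simp, intro]:
  "B \<in> carrier_mat m k \<Longrightarrow> C \<in> carrier_mat m l \<Longrightarrow> B @\<^sub>c C \<in> carrier_mat m (k + l)"
  unfolding append_cols_def by (auto intro: carrier_matI)

lemma append_cols_assoc:
  assumes "B \<in> carrier_mat m k" "C \<in> carrier_mat m l" "D \<in> carrier_mat m d"
  shows "(B @\<^sub>c C) @\<^sub>c D = B @\<^sub>c (C @\<^sub>c D)"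
  using assms by (intro eq_matI) (auto simp: append_cols_def)

lemma append_cols_mult_vec:
  fixes B C :: "real mat"
  assumes B: "B \<in> carrier_mat m k" and C: "C \<in> carrier_mat m l"
    and x: "x \<in> carrier_vec k" and y: "y \<in> carrier_vec l"
  shows "(B @\<^sub>c C) *\<^sub>v (x @\<^sub>v y) = B *\<^sub>v x + C *\<^sub>v y"
proof -
  \<comment> \<open>The empty lower blocks in the definition of \<open>append_cols\<close>
    contribute a vector of dimension 0, which the next step drops.\<close>
  have "(B @\<^sub>c C) *\<^sub>v (x @\<^sub>v y) =
      (B *\<^sub>v x + C *\<^sub>v y) @\<^sub>v (0\<^sub>m 0 k *\<^sub>v x + 0\<^sub>m 0 l *\<^sub>v y)"
    using B C unfolding append_cols_def
    by (subst four_block_mat_mult_vec[OF B C _ _ x y, of _ 0]) auto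
  also have "\<dots> = B *\<^sub>v x + C *\<^sub>v y"
    using B C x y by (intro eq_vecI) auto
  finally show ?thesis .
qed

lemma carrier_vec_append_cases:
  assumes "v \<in> carrier_vec (k + l)"
  obtains x y where "x \<in> carrier_vec k" "y \<in> carrier_vec l" "v = x @\<^sub>v y"
  using vec_first_last_append[OF assms] vec_first_carrier vec_last_carrier by metis

lemma mult_append_cols:
  fixes A B C :: "real mat"
  assumes A: "A \<in> carrier_mat m n" and B: "B \<in> carrier_mat n k" and C: "C \<in> carrier_mat n l"
  shows "A * (B @\<^sub>c C) = A * B @\<^sub>c A * C"
proof (rule eq_matI)
  fix i j assume "i < dim_row (A * B @\<^sub>c A * C)" "j < dim_col (A * B @\<^sub>c A * C)"
  then have i: "i < m" and j: "j < k + l" using A B C by (auto simp: append_cols_def)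
  have "col (B @\<^sub>c C) j = (if j < k then col B j else col C (j - k))"
    using j B C by (intro eq_vecI) (auto simp: append_cols_def)
  then show "(A * (B @\<^sub>c C)) $$ (i, j) = (A * B @\<^sub>c A * C) $$ (i, j)"
    using i j A B C by (auto simp: append_cols_def)
qed (use A B C in \<open>auto simp: append_cols_def\<close>)

lemma append_cols_inject:
  assumes "B \<in> carrier_mat m k" "B' \<in> carrier_mat m k" "C \<in> carrier_mat m l" "C' \<in> carrier_mat m l"
    and eq: "B @\<^sub>c C = B' @\<^sub>c C'"
  shows "B = B'" "C = C'"
proof -
  show "B = B'"
  proof (rule eq_matI)
    fix i j assume "i < dim_row B'" "j < dim_col B'"
    then show "B $$ (i, j) = B' $$ (i, j)"
      using assms(1-4) arg_cong[OF eq, of "\<lambda>D. D $$ (i, j)"] by (auto simp: append_cols_def)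
  qed (use assms in auto)
  show "C = C'"
  proof (rule eq_matI)
    fix i j assume "i < dim_row C'" "j < dim_col C'"
    then show "C $$ (i, j) = C' $$ (i, j)"
      using assms(1-4) arg_cong[OF eq, of "\<lambda>D. D $$ (i, k + j)"] by (auto simp: append_cols_def)
  qed (use assms in auto)
qed

section \<open>Linear algebra behind the reduction: inverse, block comparison, range, rank,
  adjoint\<close>

lemma invertible_mat_inv:
  fixes X :: "real mat"
  assumes X: "X \<in> carrier_mat n n" and inv: "invertible_mat X"
  shows "mat_inv X \<in> carrier_mat n n" "X * mat_inv X = 1\<^sub>m n" "mat_inv X * X = 1\<^sub>m n"
proof -
  obtain B where "X * B = 1\<^sub>m n" "B * X = 1\<^sub>m (dim_row B)"
    using inv X unfolding invertible_mat_def inverts_mat_def by auto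
  \<comment> \<open>The two products force the dimensions of \<open>B\<close>. Membership of
    \<open>X\<close> in the units of the matrix ring then excludes \<open>None\<close>, so
    \<open>mat_inv X\<close> is the actual inverse.\<close>
  moreover from this X have "B \<in> carrier_mat n n"
    by (metis carrier_matD(2) carrier_matI index_mult_mat(3) index_one_mat(3))
  ultimately have "X \<in> Units (ring_mat TYPE(real) n ())"
    using X by (auto simp: Units_def ring_mat_def)
  then obtain B where "mat_inverse X = Some B"
    using mat_inverse(1)[OF X, of "()"] by (cases "mat_inverse X") auto
  then show "mat_inv X \<in> carrier_mat n n" "X * mat_inv X = 1\<^sub>m n" "mat_inv X * X = 1\<^sub>m n"
    using mat_inverse(2)[OF X] by auto
qed

text \<open>Right multiplication by \<open>Y @\<^sub>c Z\<close> cancels the inverse in the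
  factorization; comparing column blocks then separates the two equations. It serves
  \<open>A\<close> and \<open>L\<close> alike.\<close>

lemma mult_blocks_of_factorization:
  fixes A P S Y Z :: "real mat"
  assumes P: "P \<in> carrier_mat m m" and S: "S \<in> carrier_mat m r"
    and Y: "Y \<in> carrier_mat n r" and Z: "Z \<in> carrier_mat n d"
    and X: "Y @\<^sub>c Z \<in> carrier_mat n n" "invertible_mat (Y @\<^sub>c Z)"
    and A: "A = P * (S @\<^sub>c 0\<^sub>m m d) * mat_inv (Y @\<^sub>c Z)"
  shows "A * Y = P * S" "A * Z = 0\<^sub>m m d"
proof -
  note inv = invertible_mat_inv[OF X]
  have n: "r + d = n" using X(1) append_cols_carrier[OF Y Z] by (metis carrier_matD(2))
  have S0: "S @\<^sub>c 0\<^sub>m m d \<in> carrier_mat m n" using S n by auto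
  have A_carrier: "A \<in> carrier_mat m n" unfolding A using P S0 inv(1) by auto
  have "A * Y @\<^sub>c A * Z = A * (Y @\<^sub>c Z)"
    using mult_append_cols[OF A_carrier Y Z] by simp
  also have "\<dots> = P * (S @\<^sub>c 0\<^sub>m m d) * (mat_inv (Y @\<^sub>c Z) * (Y @\<^sub>c Z))"
    unfolding A using P S0 inv(1) X(1) by (intro assoc_mult_mat) auto
  also have "\<dots> = P * (S @\<^sub>c 0\<^sub>m m d)"
    unfolding inv(3) using P S0 by (intro right_mult_one_mat) auto
  also have "\<dots> = P * S @\<^sub>c 0\<^sub>m m d"
    using mult_append_cols[OF P S zero_carrier_mat] P by simp
  finally show "A * Y = P * S" "A * Z = 0\<^sub>m m d"
    using append_cols_inject[of "A * Y" m r "P * S" "A * Z" d "0\<^sub>m m d"] A_carrier P S Y Z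
    by auto
qed

text \<open>Invertibility splits a range vector into a part from \<open>Y\<close> and a remainder
  from \<open>Z\<close>. The remainder is orthogonal to itself, by symmetry of \<open>M\<close>. The
  argument avoids counting dimensions, so the rank of \<open>M\<close> can be read off from the
  result.\<close>

lemma mat_range_eq_of_kernel_complement:
  fixes M Y Z :: "real mat"
  assumes M: "M \<in> carrier_mat n n" "M\<^sup>T = M"
    and Y: "Y \<in> carrier_mat n r" and Z: "Z \<in> carrier_mat n d"
    and X: "Y @\<^sub>c Z \<in> carrier_mat n n" "invertible_mat (Y @\<^sub>c Z)"
    and MZ: "M * Z = 0\<^sub>m n d"
    and cols_Y: "set (cols Y) \<subseteq> mat_range M"
  shows "mat_range M = mat_range Y"
proof
  interpret vec_space "TYPE(real)" n .
  have cols_M: "set (cols M) \<subseteq> carrier_vec n" using M by (auto simp: cols_def)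
  show YM: "mat_range Y \<subseteq> mat_range M"
    using cols_Y M(1) Y span_is_subset[OF _ span_is_submodule[OF cols_M]]
    unfolding col_space_def carrier_matD(1)[OF M(1)] carrier_matD(1)[OF Y] by blast
  show "mat_range M \<subseteq> mat_range Y"
  proof
    fix v assume v: "v \<in> mat_range M"
    then have v_carrier: "v \<in> carrier_vec n" using M by (auto simp: mat_range_eq_image[OF M(1)])
    note inv = invertible_mat_inv[OF X]
    have n: "r + d = n" using X(1) append_cols_carrier[OF Y Z] by (metis carrier_matD(2))
    obtain x y where xy: "x \<in> carrier_vec r" "y \<in> carrier_vec d"
        "mat_inv (Y @\<^sub>c Z) *\<^sub>v v = x @\<^sub>v y"
      using inv(1) v_carrier n by (metis carrier_vec_append_cases mult_mat_vec_carrier)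
    have "v = (Y @\<^sub>c Z) *\<^sub>v (mat_inv (Y @\<^sub>c Z) *\<^sub>v v)"
      using inv v_carrier X(1)
      by (metis assoc_mult_mat_vec one_mult_mat_vec)
    then have v_eq: "v = Y *\<^sub>v x + Z *\<^sub>v y"
      using append_cols_mult_vec[OF Y Z xy(1,2)] xy(3) by simp
    have Yx: "Y *\<^sub>v x \<in> mat_range M" using YM Y xy by (auto simp: mat_range_eq_image[OF Y])
    obtain a where a: "a \<in> carrier_vec n" "v = M *\<^sub>v a"
      using v M by (auto simp: mat_range_eq_image[OF M(1)])
    obtain b where b: "b \<in> carrier_vec n" "Y *\<^sub>v x = M *\<^sub>v b"
      using Yx M by (auto simp: mat_range_eq_image[OF M(1)])
    \<comment> \<open>This vector lies both in the range and in the kernel of the symmetric \<open>M\<close>.\<close>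
    let ?z = "Z *\<^sub>v y"
    have z: "?z \<in> carrier_vec n" using Z xy by auto
    have "?z = v - Y *\<^sub>v x"
      unfolding v_eq using Z Y by (intro eq_vecI) auto
    then have "?z = M *\<^sub>v (a - b)"
      using a b M by (simp add: mult_minus_distrib_mat_vec)
    then have "?z \<bullet> ?z = (M\<^sup>T *\<^sub>v (a - b)) \<bullet> ?z" using M by simp
    also have "\<dots> = (a - b) \<bullet> (M *\<^sub>v ?z)"
      using M a b z by (intro transpose_vec_mult_scalar) auto
    also have "M *\<^sub>v ?z = 0\<^sub>v n"
      using assoc_mult_mat_vec[OF M(1) Z xy(2)] MZ zero_mat_mult_vec[OF xy(2)] by simp
    also have "(a - b) \<bullet> 0\<^sub>v n = 0" using a b by simp
    \<comment> \<open>Real conjugation is the identity, so definiteness of the conjugate dot product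
      applies.\<close>
    finally have "?z = 0\<^sub>v n"
      using conjugate_square_eq_0_vec[OF z] by simp
    then have "v = Y *\<^sub>v x" using v_eq Y xy by simp
    then show "v \<in> mat_range Y" using Y xy by (auto simp: mat_range_eq_image[OF Y])
  qed
qed

text \<open>A left inverse makes \<open>Y\<close> injective on coordinate vectors, hence its columns
  independent. It is applied to \<open>Xt\<close> with the left inverse
  \<open>Xt\<^sup>T * M\<close>.\<close>

lemma mat_rank_of_left_inverse:
  fixes W Y :: "real mat"
  assumes Y: "Y \<in> carrier_mat n r" and W: "W \<in> carrier_mat r n" and WY: "W * Y = 1\<^sub>m r"
  shows "mat_rank Y = r"
proof -
  interpret vec_space "TYPE(real)" n .
  have inj: "x = W *\<^sub>v (Y *\<^sub>v x)" if "x \<in> carrier_vec r" for x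
    using that W Y WY by (metis assoc_mult_mat_vec one_mult_mat_vec)
  \<comment> \<open>Independence speaks of the set of columns, where repetitions would collapse, so
    distinctness needs its own argument: equal columns of \<open>Y\<close> would give equal columns
    of the identity \<open>W * Y\<close>.\<close>
  have distinct: "distinct (cols Y)"
  proof (subst distinct_conv_nth, intro allI impI notI)
    fix i j assume ij: "i < length (cols Y)" "j < length (cols Y)" "i \<noteq> j" "cols Y ! i = cols Y ! j"
    then have lt: "i < r" "j < r" and "col Y i = col Y j" using Y by auto
    then have "col (W * Y) i = col (W * Y) j" using W Y by simp
    then have "unit_vec r i = (unit_vec r j :: real vec)" using WY lt by simp
    then have "unit_vec r i $ i = (unit_vec r j $ i :: real)" by simp
    then show False using lt ij(3) by simp
  qed
  have "lin_indpt (set (cols Y))"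
  proof
    assume "lin_dep (set (cols Y))"
    then obtain v where v: "v \<in> carrier_vec r" "v \<noteq> 0\<^sub>v r" "Y *\<^sub>v v = 0\<^sub>v n"
      using lin_depE[OF Y _ distinct] by blast
    then have "v = 0\<^sub>v r" using inj[OF v(1)] mult_mat_zero_vec[OF W] by metis
    then show False using v by simp
  qed
  then show ?thesis using lin_indpt_full_rank[OF Y distinct] Y by simp
qed

text \<open>The map \<open>y \<mapsto> Y y\<close> carries the Euclidean inner product to
  \<open>M_inner M\<close> and is onto the range, so in these coordinates the adjoint is a
  transpose. As \<open>M_adjoint\<close> is a definite description, existence and uniqueness are
  both shown.\<close>

lemma M_adjoint_eq:
  fixes M Y B :: "real mat"
  assumes M: "M \<in> carrier_mat n n" and Y: "Y \<in> carrier_mat n r"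
    and orth: "Y\<^sup>T * M * Y = 1\<^sub>m r" and range: "mat_range M = mat_range Y"
    and B: "B \<in> carrier_mat m r" and T: "\<And>y. y \<in> carrier_vec r \<Longrightarrow> T (Y *\<^sub>v y) = B *\<^sub>v y"
    and u: "u \<in> carrier_vec m"
  shows "M_adjoint M T u = Y *\<^sub>v (B\<^sup>T *\<^sub>v u)"
proof -
  have inner: "M_inner M (Y *\<^sub>v x) (Y *\<^sub>v y) = x \<bullet> y"
    if x: "x \<in> carrier_vec r" and y: "y \<in> carrier_vec r" for x y
  proof -
    \<comment> \<open>The double transpose gives the shape in which
      \<open>transpose_vec_mult_scalar\<close> moves \<open>Y\<close> to the other side of the
      product.\<close>
    have "M_inner M (Y *\<^sub>v x) (Y *\<^sub>v y) = ((Y\<^sup>T)\<^sup>T *\<^sub>v x) \<bullet> (M *\<^sub>v (Y *\<^sub>v y))"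
      by (simp add: M_inner_def)
    also have "\<dots> = x \<bullet> (Y\<^sup>T *\<^sub>v (M *\<^sub>v (Y *\<^sub>v y)))"
      using M Y x y by (intro transpose_vec_mult_scalar) auto
    also have "Y\<^sup>T *\<^sub>v (M *\<^sub>v (Y *\<^sub>v y)) = (Y\<^sup>T * M * Y) *\<^sub>v y"
      using M Y y by (simp add: assoc_mult_mat_vec[of _ r n _ r] assoc_mult_mat_vec[of _ r n _ n])
    finally show ?thesis using orth y by simp
  qed
  have T_inner: "T (Y *\<^sub>v x) \<bullet> u = x \<bullet> (B\<^sup>T *\<^sub>v u)" if x: "x \<in> carrier_vec r" for x
  proof -
    have "T (Y *\<^sub>v x) \<bullet> u = ((B\<^sup>T)\<^sup>T *\<^sub>v x) \<bullet> u" using T x by simp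
    also have "\<dots> = x \<bullet> (B\<^sup>T *\<^sub>v u)"
      using B x u by (intro transpose_vec_mult_scalar) auto
    finally show ?thesis .
  qed
  have Btu: "B\<^sup>T *\<^sub>v u \<in> carrier_vec r" using B u by auto
  have range': "mat_range M = (*\<^sub>v) Y ` carrier_vec r"
    using range Y mat_range_eq_image[OF Y] by simp
  show ?thesis
    unfolding M_adjoint_def range'
  proof (rule the_equality)
    show "Y *\<^sub>v (B\<^sup>T *\<^sub>v u) \<in> (*\<^sub>v) Y ` carrier_vec r \<and>
      (\<forall>v\<in>(*\<^sub>v) Y ` carrier_vec r. T v \<bullet> u = M_inner M v (Y *\<^sub>v (B\<^sup>T *\<^sub>v u)))"
      using Btu inner T_inner by auto
  next
    fix w
    assume w: "w \<in> (*\<^sub>v) Y ` carrier_vec r \<and>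
      (\<forall>v\<in>(*\<^sub>v) Y ` carrier_vec r. T v \<bullet> u = M_inner M v w)"
    then obtain y where y: "y \<in> carrier_vec r" "w = Y *\<^sub>v y" by auto
    have "y = B\<^sup>T *\<^sub>v u"
    proof (rule eq_vecI)
      fix i assume "i < dim_vec (B\<^sup>T *\<^sub>v u)"
      then have i: "i < r" using Btu by (metis carrier_vecD)
      \<comment> \<open>Testing \<open>w\<close> against the images of the unit vectors under
        \<open>Y\<close> reads off its coordinates.\<close>
      have "unit_vec r i \<bullet> (B\<^sup>T *\<^sub>v u) = unit_vec r i \<bullet> y"
        using w y inner[OF _ y(1), of "unit_vec r i"] T_inner[of "unit_vec r i"] by auto
      then show "y $ i = (B\<^sup>T *\<^sub>v u) $ i" using i y Btu by simp
    qed (use y B in auto)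
    then show "w = Y *\<^sub>v (B\<^sup>T *\<^sub>v u)" using y by simp
  qed
qed

section \<open>Diagonal blocks bordered by zeros\<close>

definition corner_diag :: "nat \<Rightarrow> nat \<Rightarrow> nat \<Rightarrow> (nat \<Rightarrow> real) \<Rightarrow> real mat" where
  "corner_diag a b k d = four_block_mat (mat_diag k d) (0\<^sub>m k b) (0\<^sub>m a k) (0\<^sub>m a b)"

lemma corner_diag_carrier [simp]: "corner_diag a b k d \<in> carrier_mat (k + a) (k + b)"
  unfolding corner_diag_def by (simp add: four_block_carrier_mat)

lemma dim_corner_diag [simp]:
  "dim_row (corner_diag a b k d) = k + a" "dim_col (corner_diag a b k d) = k + b"
  using corner_diag_carrier[of a b k d] by (auto simp del: corner_diag_carrier)

lemma corner_diag_index: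
  "i < k + a \<Longrightarrow> j < k + b \<Longrightarrow> corner_diag a b k d $$ (i, j) = (if i = j \<and> i < k then d i else 0)"
  unfolding corner_diag_def by (auto simp: mat_diag_def)

text \<open>Closure under transposition lets one image lemma and one kernel lemma handle the
  operator and its adjoint, with \<open>a\<close> and \<open>b\<close> exchanged.\<close>

lemma transpose_corner_diag: "(corner_diag a b k d)\<^sup>T = corner_diag b a k d"
proof (rule eq_matI)
  fix i j assume "i < dim_row (corner_diag b a k d)" "j < dim_col (corner_diag b a k d)"
  then show "(corner_diag a b k d)\<^sup>T $$ (i, j) = corner_diag b a k d $$ (i, j)"
    by (auto simp: corner_diag_index)
qed auto

lemma corner_diag_mult_vec:
  assumes x: "x \<in> carrier_vec k" and y: "y \<in> carrier_vec b"
  shows "corner_diag a b k d *\<^sub>v (x @\<^sub>v y) = mat_diag k d *\<^sub>v x @\<^sub>v 0\<^sub>v a"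
  unfolding corner_diag_def
  by (subst four_block_mat_mult_vec[OF mat_diag_dim _ _ _ x y])
    (use x y mult_mat_vec_carrier[OF mat_diag_dim x] in \<open>auto simp: zero_mat_mult_vec\<close>)

lemma mat_diag_mult_vec:
  assumes "x \<in> carrier_vec k"
  shows "mat_diag k d *\<^sub>v x = vec k (\<lambda>i. d i * x $ i :: real)"
proof (rule eq_vecI)
  fix i assume "i < dim_vec (vec k (\<lambda>i. d i * x $ i))"
  then have i: "i < k" by simp
  then have "row (mat_diag k d) i = d i \<cdot>\<^sub>v unit_vec k i"
    by (intro eq_vecI) (auto simp: mat_diag_def)
  then show "(mat_diag k d *\<^sub>v x) $ i = vec k (\<lambda>i. d i * x $ i) $ i"
    using i assms by (simp add: mat_diag_def)
qed (simp add: mat_diag_def)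

text \<open>The zero rows discard \<open>F\<^sub>2\<close> and the zero columns discard the trailing
  coordinates; nonzero diagonal entries can be divided out, so every combination of the columns of
  \<open>F\<^sub>1\<close> is reached.\<close>

lemma corner_diag_image:
  assumes d: "\<forall>i<k. d i \<noteq> 0"
    and F: "F\<^sub>1 \<in> carrier_mat n k" "F\<^sub>2 \<in> carrier_mat n a"
  shows "(\<lambda>v. (F\<^sub>1 @\<^sub>c F\<^sub>2) *\<^sub>v (corner_diag a b k d *\<^sub>v v)) ` carrier_vec (k + b) = mat_range F\<^sub>1"
    (is "?f ` _ = _")
proof -
  have f: "?f (x @\<^sub>v y) = F\<^sub>1 *\<^sub>v (mat_diag k d *\<^sub>v x)"
    if "x \<in> carrier_vec k" "y \<in> carrier_vec b" for x y
  proof -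
    have "mat_diag k d *\<^sub>v x \<in> carrier_vec k"
      using mult_mat_vec_carrier[OF mat_diag_dim that(1)] .
    then show ?thesis
      using that F
      by (simp add: corner_diag_mult_vec append_cols_mult_vec[OF F] mult_mat_zero_vec[OF F(2)])
  qed
  show ?thesis
  proof (intro Set.set_eqI iffI)
    fix w assume "w \<in> ?f ` carrier_vec (k + b)"
    then obtain v where v: "v \<in> carrier_vec (k + b)" "w = ?f v" by auto
    obtain x y where "x \<in> carrier_vec k" "y \<in> carrier_vec b" "v = x @\<^sub>v y"
      using v(1) by (rule carrier_vec_append_cases)
    then have "w = F\<^sub>1 *\<^sub>v (mat_diag k d *\<^sub>v x)" "mat_diag k d *\<^sub>v x \<in> carrier_vec k"
      using f v mult_mat_vec_carrier[OF mat_diag_dim] by auto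
    then show "w \<in> mat_range F\<^sub>1" using F by (auto simp: mat_range_eq_image[OF F(1)])
  next
    fix w assume "w \<in> mat_range F\<^sub>1"
    then obtain z where z: "z \<in> carrier_vec k" "w = F\<^sub>1 *\<^sub>v z"
      using F by (auto simp: mat_range_eq_image[OF F(1)])
    define x where "x = vec k (\<lambda>i. z $ i / d i)"
    have x: "x \<in> carrier_vec k" by (simp add: x_def)
    have "mat_diag k d *\<^sub>v x = z"
      using z d unfolding mat_diag_mult_vec[OF x] by (intro eq_vecI) (auto simp: x_def)
    then have "w = ?f (x @\<^sub>v 0\<^sub>v b)" using f[OF x] z by simp
    then show "w \<in> ?f ` carrier_vec (k + b)" using x by (intro image_eqI) auto
  qed
qed

text \<open>Nonzero diagonal entries force the first \<open>k\<close> coordinates of a kernel vector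
  to vanish, while the trailing ones stay free and multiply only the columns of
  \<open>F\<^sub>2\<close>.\<close>

lemma corner_diag_kernel_image:
  assumes d: "\<forall>i<k. d i \<noteq> 0"
    and F: "F\<^sub>1 \<in> carrier_mat n k" "F\<^sub>2 \<in> carrier_mat n b"
  shows "(*\<^sub>v) (F\<^sub>1 @\<^sub>c F\<^sub>2) ` {v \<in> carrier_vec (k + b). corner_diag a b k d *\<^sub>v v = 0\<^sub>v (k + a)} =
    mat_range F\<^sub>2" (is "_ ` ?K = _")
proof -
  \<comment> \<open>The zero vector is split like the product, so that the upper block can be
    compared on its own.\<close>
  have zero: "0\<^sub>v (k + a) = 0\<^sub>v k @\<^sub>v (0\<^sub>v a :: real vec)" by (intro eq_vecI) auto
  show ?thesis
  proof (intro Set.set_eqI iffI)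
    fix w assume "w \<in> (*\<^sub>v) (F\<^sub>1 @\<^sub>c F\<^sub>2) ` ?K"
    then obtain v where v: "v \<in> carrier_vec (k + b)" "corner_diag a b k d *\<^sub>v v = 0\<^sub>v (k + a)"
        "w = (F\<^sub>1 @\<^sub>c F\<^sub>2) *\<^sub>v v" by auto
    obtain x y where xy: "x \<in> carrier_vec k" "y \<in> carrier_vec b" "v = x @\<^sub>v y"
      using v(1) by (rule carrier_vec_append_cases)
    have Dx: "mat_diag k d *\<^sub>v x = 0\<^sub>v k"
      using v(2) xy corner_diag_mult_vec[OF xy(1,2)] zero
        append_vec_eq[OF mult_mat_vec_carrier[OF mat_diag_dim xy(1)] zero_carrier_vec] by metis
    have "x = 0\<^sub>v k"
    proof (rule eq_vecI)
      fix i assume "i < dim_vec (0\<^sub>v k :: real vec)"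
      then have i: "i < k" by simp
      then have "d i * x $ i = 0"
        using arg_cong[OF Dx, of "\<lambda>v. v $ i"] xy by (simp add: mat_diag_mult_vec)
      then show "x $ i = 0\<^sub>v k $ i" using d i by simp
    qed (use xy in auto)
    then have "w = F\<^sub>2 *\<^sub>v y"
      using v xy F by (simp add: append_cols_mult_vec[OF F] mult_mat_zero_vec[OF F(1)])
    then show "w \<in> mat_range F\<^sub>2" using xy F by (auto simp: mat_range_eq_image[OF F(2)])
  next
    fix w assume "w \<in> mat_range F\<^sub>2"
    then obtain y where y: "y \<in> carrier_vec b" "w = F\<^sub>2 *\<^sub>v y"
      using F by (auto simp: mat_range_eq_image[OF F(2)])
    have "mat_diag k d *\<^sub>v 0\<^sub>v k = 0\<^sub>v k" by (intro eq_vecI) (auto simp: mat_diag_mult_vec)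
    then have "0\<^sub>v k @\<^sub>v y \<in> ?K" using y zero by (simp add: corner_diag_mult_vec)
    moreover have "w = (F\<^sub>1 @\<^sub>c F\<^sub>2) *\<^sub>v (0\<^sub>v k @\<^sub>v y)"
      using y F by (simp add: append_cols_mult_vec[OF F] mult_mat_zero_vec[OF F(1)])
    ultimately show "w \<in> (*\<^sub>v) (F\<^sub>1 @\<^sub>c F\<^sub>2) ` ?K" by (intro image_eqI) auto
  qed
qed

text \<open>The identity block and the block of \<open>c\<close> values merge into one diagonal of
  size \<open>q1 + q2\<close>. For \<open>i \<ge> q1\<close> the entry is
  \<open>c (q1 + 1 + (i - q1))\<close>, that is \<open>c (i + 1)\<close>.\<close>

lemma gsvd_Sigma_A_eq_corner_diag:
  "gsvd_Sigma_A m q1 q2 q3 c =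
    corner_diag (m - q1 - q2) q3 (q1 + q2) (\<lambda>i. if i < q1 then 1 else c (i + 1))"
    (is "?S = ?D")
proof (rule eq_matI)
  have S: "?S \<in> carrier_mat (q1 + q2 + (m - q1 - q2)) (q1 + q2 + q3)"
    unfolding gsvd_Sigma_A_def by (auto simp: Let_def mat_diag_def)
  show "dim_row ?S = dim_row ?D" "dim_col ?S = dim_col ?D"
    using S by auto
  fix i j assume "i < dim_row ?D" "j < dim_col ?D"
  then have "i < q1 + q2 + (m - q1 - q2)" "j < q1 + q2 + q3" by auto
  then show "?S $$ (i, j) = ?D $$ (i, j)"
    by (subst corner_diag_index) (auto simp: gsvd_Sigma_A_def Let_def mat_diag_def)
qed

text \<open>The bound makes the truncated difference \<open>p - q2 - q3\<close> complete the row
  count to \<open>p\<close>.\<close>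

lemma gsvd_Sigma_L_carrier:
  "q2 + q3 \<le> p \<Longrightarrow> gsvd_Sigma_L p q1 q2 q3 s \<in> carrier_mat p (q1 + q2 + q3)"
  unfolding gsvd_Sigma_L_def by (auto simp: Let_def mat_diag_def)

theorem theorem3p2:
  fixes A L M P\<^sub>A P\<^sub>L X P\<^sub>A\<^sub>1 P\<^sub>A\<^sub>2 P\<^sub>A\<^sub>3 X\<^sub>1 X\<^sub>2 X\<^sub>3 X\<^sub>4 Xt :: "real mat"
    and m n p r q1 q2 q3 :: nat
    and c s :: "nat \<Rightarrow> real"
    and opA :: "real vec \<Rightarrow> real vec"
  assumes A: "A \<in> carrier_mat m n"
    and L: "L \<in> carrier_mat p n"
    and r: "mat_rank (A @\<^sub>r L) = r"
    and M: "M = A\<^sup>T * A + L\<^sup>T * L"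
    and gsvd: "is_gsvd A L q1 q2 q3 c s P\<^sub>A P\<^sub>L X"
    and x_range: "\<forall>i<r. col X i \<in> mat_range M"
    and opA: "opA = (\<lambda>v\<in>mat_range M. A *\<^sub>v v)"
    and P_blocks: "P\<^sub>A = P\<^sub>A\<^sub>1 @\<^sub>c P\<^sub>A\<^sub>2 @\<^sub>c P\<^sub>A\<^sub>3"
      "P\<^sub>A\<^sub>1 \<in> carrier_mat m q1" "P\<^sub>A\<^sub>2 \<in> carrier_mat m q2" "P\<^sub>A\<^sub>3 \<in> carrier_mat m (m - q1 - q2)"
    and X_blocks: "X = X\<^sub>1 @\<^sub>c X\<^sub>2 @\<^sub>c X\<^sub>3 @\<^sub>c X\<^sub>4"
      "X\<^sub>1 \<in> carrier_mat n q1" "X\<^sub>2 \<in> carrier_mat n q2" "X\<^sub>3 \<in> carrier_mat n q3"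
      "X\<^sub>4 \<in> carrier_mat n (n - r)"
    and Xt: "Xt = X\<^sub>1 @\<^sub>c X\<^sub>2 @\<^sub>c X\<^sub>3"
  shows "is_sve M m opA P\<^sub>A (gsvd_Sigma_A m q1 q2 q3 c) Xt
    \<and> {v \<in> mat_range M. opA v = 0\<^sub>v m} = mat_range X\<^sub>3
    \<and> opA ` mat_range M = mat_range (P\<^sub>A\<^sub>1 @\<^sub>c P\<^sub>A\<^sub>2)
    \<and> {u \<in> carrier_vec m. M_adjoint M opA u = 0\<^sub>v n} = mat_range P\<^sub>A\<^sub>3
    \<and> M_adjoint M opA ` carrier_vec m = mat_range (X\<^sub>1 @\<^sub>c X\<^sub>2)"
proof -

  \<comment> \<open>Block sizes and the factorizations on the blocks of \<open>X\<close>\<close>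
  define k where "k = q1 + q2"
  define a where "a = m - q1 - q2"
  define d where "d = (\<lambda>i. if i < q1 then 1 else c (i + 1))"
  define S where "S = gsvd_Sigma_A m q1 q2 q3 c"
  define SL where "SL = gsvd_Sigma_L p q1 q2 q3 s"
  have dims: "dim_row A = m" "dim_col A = n" "dim_row L = p" using A L by auto
  have g: "q1 + q2 + q3 = r" "q1 + q2 \<le> m" "q2 + q3 \<le> p"
      "\<forall>i\<in>{q1+1..q1+q2}. 0 < c i"
      "S\<^sup>T * S + SL\<^sup>T * SL = 1\<^sub>m r"
      "orthonormal_mat m P\<^sub>A" "orthonormal_mat p P\<^sub>L"
      "X \<in> carrier_mat n n" "invertible_mat X"
      "A = P\<^sub>A * (S @\<^sub>c 0\<^sub>m m (n - r)) * mat_inv X"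
      "L = P\<^sub>L * (SL @\<^sub>c 0\<^sub>m p (n - r)) * mat_inv X"
    using gsvd unfolding is_gsvd_def Let_def dims r S_def SL_def by blast+
  have kr: "k + q3 = r" and km: "k + a = m" using g by (auto simp: k_def a_def)
  \<comment> \<open>For \<open>q1 \<le> i < k\<close> the shifted index \<open>i + 1\<close> lies in
    \<open>{q1+1..q1+q2}\<close>, where the GSVD makes \<open>c\<close> positive.\<close>
  have d_pos: "0 < d i" if "i < k" for i
    using that g(4) by (auto simp: d_def k_def)
  then have d_nz: "\<forall>i<k. d i \<noteq> 0" by force
  have S_eq: "S = corner_diag a q3 k d"
    unfolding S_def d_def a_def k_def by (rule gsvd_Sigma_A_eq_corner_diag)
  have S: "S \<in> carrier_mat m r"
    using corner_diag_carrier[of a q3 k d] unfolding S_eq kr km .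
  have ST_eq: "S\<^sup>T = corner_diag q3 a k d" unfolding S_eq by (rule transpose_corner_diag)
  have SL: "SL \<in> carrier_mat p r"
    using gsvd_Sigma_L_carrier[OF g(3)] g(1) unfolding SL_def by auto
  have PA: "P\<^sub>A \<in> carrier_mat m m" "P\<^sub>A\<^sup>T * P\<^sub>A = 1\<^sub>m m" "P\<^sub>A * P\<^sub>A\<^sup>T = 1\<^sub>m m"
    and PL: "P\<^sub>L \<in> carrier_mat p p" "P\<^sub>L\<^sup>T * P\<^sub>L = 1\<^sub>m p"
    using g by (auto simp: orthonormal_mat_def)
  have X12: "X\<^sub>1 @\<^sub>c X\<^sub>2 \<in> carrier_mat n k" using X_blocks by (auto simp: k_def)
  have P12: "P\<^sub>A\<^sub>1 @\<^sub>c P\<^sub>A\<^sub>2 \<in> carrier_mat m k" using P_blocks by (auto simp: k_def)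
  have P3: "P\<^sub>A\<^sub>3 \<in> carrier_mat m a" using P_blocks by (simp add: a_def)
  \<comment> \<open>Regrouping turns the first \<open>k\<close> columns into one block, matching the
    merged diagonal in \<open>corner_diag\<close>; the same is done for \<open>Xt\<close>.\<close>
  have PA_eq: "P\<^sub>A = (P\<^sub>A\<^sub>1 @\<^sub>c P\<^sub>A\<^sub>2) @\<^sub>c P\<^sub>A\<^sub>3"
    unfolding P_blocks(1) using append_cols_assoc[OF P_blocks(2-4)] by simp
  have Xt_eq: "Xt = (X\<^sub>1 @\<^sub>c X\<^sub>2) @\<^sub>c X\<^sub>3"
    unfolding Xt using append_cols_assoc[OF X_blocks(2-4)] by simp
  have Y: "Xt \<in> carrier_mat n r"
    unfolding Xt_eq kr[symmetric] using X12 X_blocks(4) by blast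
  have X_eq: "X = Xt @\<^sub>c X\<^sub>4"
  proof -
    have "X\<^sub>3 @\<^sub>c X\<^sub>4 \<in> carrier_mat n (q3 + (n - r))" using X_blocks by blast
    then show ?thesis
      unfolding X_blocks(1) Xt_eq
      using append_cols_assoc[OF X12 X_blocks(4,5)] append_cols_assoc[OF X_blocks(2,3)] by simp
  qed
  have AXt: "A * Xt = P\<^sub>A * S" and AX4: "A * X\<^sub>4 = 0\<^sub>m m (n - r)"
    using mult_blocks_of_factorization[OF PA(1) S Y X_blocks(5)] g(8-10) unfolding X_eq by auto
  have LXt: "L * Xt = P\<^sub>L * SL" and LX4: "L * X\<^sub>4 = 0\<^sub>m p (n - r)"
    using mult_blocks_of_factorization[OF PL(1) SL Y X_blocks(5)] g(8,9,11) unfolding X_eq by auto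

  \<comment> \<open>The matrix \<open>M\<close>: orthonormality, range and rank\<close>
  have M_carrier: "M \<in> carrier_mat n n" unfolding M using A L by auto
  have M_sym: "M\<^sup>T = M"
    unfolding M using A L by (simp add: transpose_add[of _ n n] transpose_mult[of _ n _ _ n] transpose_mult)
  have M_mult: "M * Z = A\<^sup>T * (A * Z) + L\<^sup>T * (L * Z)" if Z: "Z \<in> carrier_mat n l" for Z l
  proof -
    have "M * Z = A\<^sup>T * A * Z + L\<^sup>T * L * Z"
      unfolding M using A L Z by (intro add_mult_distrib_mat) auto
    then show ?thesis
      using A L Z assoc_mult_mat[of "A\<^sup>T" n m A n Z l] assoc_mult_mat[of "L\<^sup>T" n p L n Z l] by simp
  qed
  have MX4: "M * X\<^sub>4 = 0\<^sub>m n (n - r)"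
    unfolding M_mult[OF X_blocks(5)] AX4 LX4 using A L by simp
  \<comment> \<open>The orthogonal factor cancels. The instances for \<open>A\<close> and
    \<open>L\<close> add up to the left side of the GSVD normalization, which is the
    identity.\<close>
  have gram: "Xt\<^sup>T * (B\<^sup>T * (B * Xt)) = R\<^sup>T * R"
    if B: "B \<in> carrier_mat l n" and P: "P \<in> carrier_mat l l" "P\<^sup>T * P = 1\<^sub>m l"
      and R: "R \<in> carrier_mat l r" and BXt: "B * Xt = P * R" for B P R l
  proof -
    have "Xt\<^sup>T * (B\<^sup>T * (B * Xt)) = Xt\<^sup>T * B\<^sup>T * (B * Xt)"
      using B Y by (intro assoc_mult_mat[symmetric]) auto
    also have "\<dots> = (P * R)\<^sup>T * (P * R)"
      using transpose_mult[OF B Y] BXt by simp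
    also have "\<dots> = R\<^sup>T * P\<^sup>T * (P * R)"
      using transpose_mult[OF P(1) R] by simp
    also have "\<dots> = R\<^sup>T * (P\<^sup>T * (P * R))"
      using P R by (intro assoc_mult_mat) auto
    also have "P\<^sup>T * (P * R) = P\<^sup>T * P * R"
      using P R by (intro assoc_mult_mat[symmetric]) auto
    finally show ?thesis using P R by simp
  qed
  have orth: "Xt\<^sup>T * M * Xt = 1\<^sub>m r"
  proof -
    have "Xt\<^sup>T * M * Xt = Xt\<^sup>T * (M * Xt)"
      using M_carrier Y by (intro assoc_mult_mat) auto
    also have "\<dots> = Xt\<^sup>T * (A\<^sup>T * (A * Xt)) + Xt\<^sup>T * (L\<^sup>T * (L * Xt))"
      unfolding M_mult[OF Y] using A L Y by (intro mult_add_distrib_mat) auto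
    also have "\<dots> = S\<^sup>T * S + SL\<^sup>T * SL"
      using gram[OF A PA(1,2) S AXt] gram[OF L PL SL LXt] by simp
    finally show ?thesis using g(5) by simp
  qed
  have cols_Xt: "set (cols Xt) \<subseteq> mat_range M"
  proof
    fix v assume "v \<in> set (cols Xt)"
    then obtain i where i: "i < r" "v = col Xt i"
      using Y by (auto simp: cols_def)
    have "col X i = col Xt i"
      using i Y X_blocks(5) unfolding X_eq by (intro eq_vecI) (auto simp: append_cols_def)
    then show "v \<in> mat_range M" using x_range i by auto
  qed
  have range: "mat_range M = mat_range Xt"
    using mat_range_eq_of_kernel_complement[OF M_carrier M_sym Y X_blocks(5) _ _ MX4 cols_Xt] g(8,9)
    unfolding X_eq by blast
  then have range': "mat_range M = (*\<^sub>v) Xt ` carrier_vec r"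
    using mat_range_eq_image[OF Y] Y by simp
  have "mat_rank Xt = r"
    using mat_rank_of_left_inverse[OF Y _ orth] M_carrier Y by auto
  \<comment> \<open>The rank is the dimension of the column space, so it passes from
    \<open>Xt\<close> to \<open>M\<close>.\<close>
  then have rank: "mat_rank M = r"
    using range M_carrier Y unfolding vec_space.rank_def vec_space.col_space_def by simp

  \<comment> \<open>The operator and its adjoint in the coordinates given by
    \<open>Xt\<close>\<close>
  have opA_eq: "opA (Xt *\<^sub>v y) = (P\<^sub>A * S) *\<^sub>v y" if y: "y \<in> carrier_vec r" for y
  proof -
    \<comment> \<open>Outside the range of \<open>M\<close> the restricted \<open>opA\<close> is
      \<open>undefined\<close>; vectors of the form \<open>Xt y\<close> lie inside.\<close>
    have "opA (Xt *\<^sub>v y) = A *\<^sub>v (Xt *\<^sub>v y)"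
      unfolding opA range' using y by auto
    then show ?thesis using assoc_mult_mat_vec[OF A Y y] AXt by simp
  qed
  have PS: "P\<^sub>A * S \<in> carrier_mat m r" using PA S by auto
  have adj: "M_adjoint M opA u = Xt *\<^sub>v (S\<^sup>T *\<^sub>v (P\<^sub>A\<^sup>T *\<^sub>v u))" if u: "u \<in> carrier_vec m" for u
  proof -
    have "M_adjoint M opA u = Xt *\<^sub>v ((P\<^sub>A * S)\<^sup>T *\<^sub>v u)"
      by (rule M_adjoint_eq[OF M_carrier Y orth range PS opA_eq u])
    also have "(P\<^sub>A * S)\<^sup>T *\<^sub>v u = S\<^sup>T *\<^sub>v (P\<^sub>A\<^sup>T *\<^sub>v u)"
      unfolding transpose_mult[OF PA(1) S] using PA S u by (intro assoc_mult_mat_vec) auto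
    finally show ?thesis .
  qed
  \<comment> \<open>Recovering coordinates by \<open>Xt\<^sup>T * M\<close> serves both the last
    factors of the expansion and the injectivity of \<open>Xt\<close>.\<close>
  have Xt_inj: "Xt\<^sup>T * M *\<^sub>v (Xt *\<^sub>v y) = y" if "y \<in> carrier_vec r" for y
  proof -
    have "Xt\<^sup>T * M *\<^sub>v (Xt *\<^sub>v y) = (Xt\<^sup>T * M * Xt) *\<^sub>v y"
      using M_carrier Y that by (intro assoc_mult_mat_vec[symmetric]) auto
    then show ?thesis using orth that by simp
  qed
  have PTP: "P\<^sub>A\<^sup>T *\<^sub>v (P\<^sub>A *\<^sub>v z) = z" "P\<^sub>A *\<^sub>v (P\<^sub>A\<^sup>T *\<^sub>v z) = z" "P\<^sub>A\<^sup>T *\<^sub>v z \<in> carrier_vec m"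
    if "z \<in> carrier_vec m" for z
  proof -
    have "P\<^sub>A\<^sup>T *\<^sub>v (P\<^sub>A *\<^sub>v z) = (P\<^sub>A\<^sup>T * P\<^sub>A) *\<^sub>v z" "P\<^sub>A *\<^sub>v (P\<^sub>A\<^sup>T *\<^sub>v z) = (P\<^sub>A * P\<^sub>A\<^sup>T) *\<^sub>v z"
      using PA(1) that by (intro assoc_mult_mat_vec[symmetric]; auto)+
    then show "P\<^sub>A\<^sup>T *\<^sub>v (P\<^sub>A *\<^sub>v z) = z" "P\<^sub>A *\<^sub>v (P\<^sub>A\<^sup>T *\<^sub>v z) = z" "P\<^sub>A\<^sup>T *\<^sub>v z \<in> carrier_vec m"
      using PA that by auto
  qed
  have opA_eq': "opA (Xt *\<^sub>v y) = P\<^sub>A *\<^sub>v (S *\<^sub>v y)" if "y \<in> carrier_vec r" for y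
    using opA_eq[OF that] assoc_mult_mat_vec[OF PA(1) S that] by simp
  have Sv: "S *\<^sub>v y \<in> carrier_vec m" if "y \<in> carrier_vec r" for y
    using S that by auto
  have STv: "S\<^sup>T *\<^sub>v z \<in> carrier_vec r" if "z \<in> carrier_vec m" for z
    using S that by auto

  \<comment> \<open>The singular value expansion\<close>
  have sve: "is_sve M m opA P\<^sub>A S Xt"
    unfolding is_sve_def rank
  proof (intro conjI ballI allI impI)
    show "Xt \<in> carrier_mat (dim_row M) r" using Y M_carrier by simp
    show "set (cols Xt) \<subseteq> mat_range M" by (rule cols_Xt)
    show "diagonal_mat S" unfolding S_eq diagonal_mat_def by (auto simp: corner_diag_index)
    show "0 \<le> S $$ (i, j)" if "i < m" "j < r" for i j
    proof -
      have "i < k + a" "j < k + q3" using that kr km by auto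
      then show ?thesis
        unfolding S_eq using d_pos[of i] by (auto simp: corner_diag_index)
    qed
    fix v assume "v \<in> mat_range M"
    then obtain y where y: "y \<in> carrier_vec r" "v = Xt *\<^sub>v y" unfolding range' by auto
    \<comment> \<open>The factors are regrouped so that \<open>Xt\<^sup>T * M\<close> acts first and
      returns the coordinates \<open>y\<close> of \<open>v\<close>.\<close>
    have "(P\<^sub>A * S * Xt\<^sup>T * M) *\<^sub>v v = (P\<^sub>A * S * (Xt\<^sup>T * M)) *\<^sub>v v"
      using PS Y M_carrier by (subst assoc_mult_mat[of _ m r _ n _ n]) auto
    also have "\<dots> = (P\<^sub>A * S) *\<^sub>v ((Xt\<^sup>T * M) *\<^sub>v v)"
      using PS Y M_carrier y by (intro assoc_mult_mat_vec) auto
    also have "\<dots> = opA v" unfolding y(2) Xt_inj[OF y(1)] opA_eq[OF y(1)] ..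
    finally show "opA v = (P\<^sub>A * S * Xt\<^sup>T * M) *\<^sub>v v" by simp
  next
    fix u :: "real vec" assume u: "u \<in> carrier_vec m"
    have "(Xt * S\<^sup>T * P\<^sub>A\<^sup>T) *\<^sub>v u = (Xt * S\<^sup>T) *\<^sub>v (P\<^sub>A\<^sup>T *\<^sub>v u)"
      using Y S PA u by (intro assoc_mult_mat_vec) auto
    also have "\<dots> = Xt *\<^sub>v (S\<^sup>T *\<^sub>v (P\<^sub>A\<^sup>T *\<^sub>v u))"
      using Y S PTP(3)[OF u] by (intro assoc_mult_mat_vec) auto
    finally show "M_adjoint M opA u = (Xt * S\<^sup>T * P\<^sub>A\<^sup>T) *\<^sub>v u" using adj[OF u] by simp
  qed (use orth g(6) S in auto)

  \<comment> \<open>Kernels and images of the operator and its adjoint\<close>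
  have Xt0: "Xt *\<^sub>v 0\<^sub>v r = 0\<^sub>v n" by (rule mult_mat_zero_vec[OF Y])
  have PA0: "P\<^sub>A *\<^sub>v 0\<^sub>v m = 0\<^sub>v m" by (rule mult_mat_zero_vec[OF PA(1)])

  \<comment> \<open>\<open>P\<^sub>A\<close> is injective, with left inverse
    \<open>P\<^sub>A\<^sup>T\<close>, so in coordinates the kernel is that of
    \<open>S\<close>.\<close>
  have "opA (Xt *\<^sub>v y) = 0\<^sub>v m \<longleftrightarrow> S *\<^sub>v y = 0\<^sub>v m" if y: "y \<in> carrier_vec r" for y
    using opA_eq'[OF y] PTP(1)[OF Sv[OF y]] PTP(1)[of "0\<^sub>v m"] PA0 by (metis zero_carrier_vec)
  then have "{v \<in> mat_range M. opA v = 0\<^sub>v m} = (*\<^sub>v) Xt ` {y \<in> carrier_vec r. S *\<^sub>v y = 0\<^sub>v m}"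
    unfolding range' by auto
  also have "\<dots> = mat_range X\<^sub>3"
    using corner_diag_kernel_image[where a = a, OF d_nz X12 X_blocks(4)]
    unfolding S_eq Xt_eq kr km by simp
  finally have ker: "{v \<in> mat_range M. opA v = 0\<^sub>v m} = mat_range X\<^sub>3" .

  have "opA ` mat_range M = (\<lambda>y. P\<^sub>A *\<^sub>v (S *\<^sub>v y)) ` carrier_vec r"
    unfolding range' image_image using opA_eq' by (intro image_cong) auto
  also have "\<dots> = mat_range (P\<^sub>A\<^sub>1 @\<^sub>c P\<^sub>A\<^sub>2)"
    using corner_diag_image[where b = q3, OF d_nz P12 P3] unfolding S_eq PA_eq kr km by simp
  finally have im: "opA ` mat_range M = mat_range (P\<^sub>A\<^sub>1 @\<^sub>c P\<^sub>A\<^sub>2)" .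

  have PA_surj: "(\<lambda>u. P\<^sub>A\<^sup>T *\<^sub>v u) ` carrier_vec m = carrier_vec m"
  proof
    show "carrier_vec m \<subseteq> (\<lambda>u. P\<^sub>A\<^sup>T *\<^sub>v u) ` carrier_vec m"
    proof
      fix z :: "real vec" assume z: "z \<in> carrier_vec m"
      then have "P\<^sub>A *\<^sub>v z \<in> carrier_vec m" using PA(1) by auto
      then show "z \<in> (\<lambda>u. P\<^sub>A\<^sup>T *\<^sub>v u) ` carrier_vec m"
        using PTP(1)[OF z] by (metis imageI)
    qed
  qed (use PTP(3) in auto)

  have adj0: "M_adjoint M opA u = 0\<^sub>v n \<longleftrightarrow> S\<^sup>T *\<^sub>v (P\<^sub>A\<^sup>T *\<^sub>v u) = 0\<^sub>v r"
    if u: "u \<in> carrier_vec m" for u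
    using adj[OF u] Xt_inj[OF STv[OF PTP(3)[OF u]]] Xt_inj[of "0\<^sub>v r"] Xt0 by (metis zero_carrier_vec)
  \<comment> \<open>The substitution \<open>u = P\<^sub>A z\<close> is a bijection by orthogonality
    and reduces the condition to the kernel of \<open>S\<^sup>T\<close>.\<close>
  have "{u \<in> carrier_vec m. M_adjoint M opA u = 0\<^sub>v n} =
      (*\<^sub>v) P\<^sub>A ` {z \<in> carrier_vec m. S\<^sup>T *\<^sub>v z = 0\<^sub>v r}" (is "?l = ?r")
  proof
    show "?l \<subseteq> ?r"
    proof
      fix u assume "u \<in> ?l"
      then have "u = P\<^sub>A *\<^sub>v (P\<^sub>A\<^sup>T *\<^sub>v u)" "P\<^sub>A\<^sup>T *\<^sub>v u \<in> {z \<in> carrier_vec m. S\<^sup>T *\<^sub>v z = 0\<^sub>v r}"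
        using PTP adj0 by auto
      then show "u \<in> ?r" by blast
    qed
    show "?r \<subseteq> ?l" using adj0 PTP PA(1) by auto
  qed
  \<comment> \<open>The transpose has \<open>q3\<close> zero rows and \<open>a\<close> zero columns,
    so the kernel lemma now selects the last \<open>a\<close> columns of
    \<open>P\<^sub>A\<close>.\<close>
  also have "\<dots> = mat_range P\<^sub>A\<^sub>3"
    using corner_diag_kernel_image[where a = q3, OF d_nz P12 P3]
    unfolding ST_eq PA_eq kr km by simp
  finally have ker_adj: "{u \<in> carrier_vec m. M_adjoint M opA u = 0\<^sub>v n} = mat_range P\<^sub>A\<^sub>3" .

  have "M_adjoint M opA ` carrier_vec m =
      (\<lambda>z. Xt *\<^sub>v (S\<^sup>T *\<^sub>v z)) ` ((\<lambda>u. P\<^sub>A\<^sup>T *\<^sub>v u) ` carrier_vec m)"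
    unfolding image_image using adj by (intro image_cong) auto
  also have "\<dots> = (\<lambda>z. Xt *\<^sub>v (S\<^sup>T *\<^sub>v z)) ` carrier_vec m" unfolding PA_surj ..
  also have "\<dots> = mat_range (X\<^sub>1 @\<^sub>c X\<^sub>2)"
    using corner_diag_image[where b = a, OF d_nz X12 X_blocks(4)] unfolding ST_eq Xt_eq kr km by simp
  finally have im_adj: "M_adjoint M opA ` carrier_vec m = mat_range (X\<^sub>1 @\<^sub>c X\<^sub>2)" .

  show ?thesis using sve ker im ker_adj im_adj unfolding S_def by blast
qed

end
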